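(* Let $X$ and $Y$ be real Banach spaces and let $K\colon X\to Y$ be a bounded dilinear mapping. Then the bounded representative $\breve K$ is unique, i.e. there is exactly one bounded linear mapping $\breve K\colon X\times(X\otimes_{\pi,\mathrm{sym}}X)\to Y$ with $K(u)=\breve K(u,u\otimes u)$ for all $u\in X$.
   Context: For a real Banach space $X$, $X\otimes_\pi X$ is the (completed) projective tensor product and $X\otimes_{\pi,\mathrm{sym}}X$ is its closed subspace spanned by the tensors $u\otimes u$, $u\in X$. A mapping $K\colon X\to Y$ is dilinear if there is a linear mapping (representative) $\breve K\colon X\times(X\otimes_{\pi,\mathrm{sym}}X)\to Y$ with $K(u)=\breve K(u,u\otimes u)$ for all $u\in X$; $K$ is bounded if it has a bounded linear representative $\breve K$. *)

theory Defs
  imports "HOL-Analysis.Analysis" "HOL-Analysis.Finite_Function_Topology"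
begin

section \<open>The algebraic tensor product\<close>

text \<open>
  The free real vector space on \<open>X \<times> Y\<close> modulo the subspace generated by the
  bilinearity relations.
\<close>

definition tensor_relations :: "(('a::real_vector \<times> 'b::real_vector) \<Rightarrow>\<^sub>0 real) set" where
  "tensor_relations = span
    ({Poly_Mapping.single (x + x', y) 1 - Poly_Mapping.single (x, y) 1
        - Poly_Mapping.single (x', y) 1 | x x' y. True} \<union>
     {Poly_Mapping.single (x, y + y') 1 - Poly_Mapping.single (x, y) 1
        - Poly_Mapping.single (x, y') 1 | x y y'. True} \<union>
     {Poly_Mapping.single (c *\<^sub>R x, y) 1 - c *\<^sub>R Poly_Mapping.single (x, y) 1 | c x y. True} \<union>
     {Poly_Mapping.single (x, c *\<^sub>R y) 1 - c *\<^sub>R Poly_Mapping.single (x, y) 1 | c x y. True})"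

lemma tensor_relations_add:
  "f \<in> tensor_relations \<Longrightarrow> g \<in> tensor_relations \<Longrightarrow> f + g \<in> tensor_relations"
  unfolding tensor_relations_def by (rule span_add)

lemma tensor_relations_diff:
  "f \<in> tensor_relations \<Longrightarrow> g \<in> tensor_relations \<Longrightarrow> f - g \<in> tensor_relations"
  unfolding tensor_relations_def by (rule span_diff)

lemma tensor_relations_scale: "f \<in> tensor_relations \<Longrightarrow> c *\<^sub>R f \<in> tensor_relations"
  unfolding tensor_relations_def by (rule span_scale)

lemma tensor_relations_0: "0 \<in> tensor_relations"
  unfolding tensor_relations_def by (rule span_zero)

quotient_type (overloaded) ('a, 'b) alg_tensor =
  "('a::real_vector \<times> 'b::real_vector) \<Rightarrow>\<^sub>0 real" / "\<lambda>f g. f - g \<in> tensor_relations"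
proof (rule equivpI)
  show "reflp (\<lambda>f g::('a \<times> 'b) \<Rightarrow>\<^sub>0 real. f - g \<in> tensor_relations)"
    by (simp add: reflp_def tensor_relations_0)
  show "symp (\<lambda>f g::('a \<times> 'b) \<Rightarrow>\<^sub>0 real. f - g \<in> tensor_relations)"
  proof (rule sympI)
    fix f g :: "('a \<times> 'b) \<Rightarrow>\<^sub>0 real"
    assume "f - g \<in> tensor_relations"
    then show "g - f \<in> tensor_relations"
      using tensor_relations_scale[of "f - g" "-1"] by simp
  qed
  show "transp (\<lambda>f g::('a \<times> 'b) \<Rightarrow>\<^sub>0 real. f - g \<in> tensor_relations)"
  proof (rule transpI)
    fix f g h :: "('a \<times> 'b) \<Rightarrow>\<^sub>0 real"
    assume "f - g \<in> tensor_relations" "g - h \<in> tensor_relations"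
    then show "f - h \<in> tensor_relations"
      using tensor_relations_add[of "f - g" "g - h"] by simp
  qed
qed

instantiation alg_tensor :: (real_vector, real_vector) real_vector
begin

lift_definition zero_alg_tensor :: "('a, 'b) alg_tensor" is 0 .

lift_definition plus_alg_tensor ::
  "('a, 'b) alg_tensor \<Rightarrow> ('a, 'b) alg_tensor \<Rightarrow> ('a, 'b) alg_tensor" is "(+)"
  subgoal for f f' g g'
    using tensor_relations_add[of "f - f'" "g - g'"] by (simp add: algebra_simps)
  done

lift_definition minus_alg_tensor ::
  "('a, 'b) alg_tensor \<Rightarrow> ('a, 'b) alg_tensor \<Rightarrow> ('a, 'b) alg_tensor" is "(-)"
  subgoal for f f' g g'
    using tensor_relations_diff[of "f - f'" "g - g'"] by (simp add: algebra_simps)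
  done

lift_definition uminus_alg_tensor :: "('a, 'b) alg_tensor \<Rightarrow> ('a, 'b) alg_tensor" is uminus
  subgoal for f f'
    using tensor_relations_scale[of "f - f'" "-1"] by (simp add: algebra_simps)
  done

lift_definition scaleR_alg_tensor :: "real \<Rightarrow> ('a, 'b) alg_tensor \<Rightarrow> ('a, 'b) alg_tensor" is "(*\<^sub>R)"
  by (simp add: tensor_relations_scale flip: scaleR_diff_right)

instance
  by standard (transfer; simp add: tensor_relations_0 algebra_simps)+

end

lift_definition alg_tensor_of :: "'a::real_vector \<Rightarrow> 'b::real_vector \<Rightarrow> ('a, 'b) alg_tensor" is
  "\<lambda>x y. Poly_Mapping.single (x, y) 1" .

lemma alg_tensor_of_add_left: "alg_tensor_of (x + x') y = alg_tensor_of x y + alg_tensor_of x' y"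
  by transfer (unfold tensor_relations_def diff_diff_eq[symmetric], rule span_base, blast)

lemma alg_tensor_of_add_right: "alg_tensor_of x (y + y') = alg_tensor_of x y + alg_tensor_of x y'"
  by transfer (unfold tensor_relations_def diff_diff_eq[symmetric], rule span_base, blast)

lemma alg_tensor_of_scale_left: "alg_tensor_of (c *\<^sub>R x) y = c *\<^sub>R alg_tensor_of x y"
  by transfer (unfold tensor_relations_def, rule span_base, blast)

lemma alg_tensor_of_scale_right: "alg_tensor_of x (c *\<^sub>R y) = c *\<^sub>R alg_tensor_of x y"
  by transfer (unfold tensor_relations_def, rule span_base, blast)

lemma alg_tensor_exhaust:
  "\<exists>ps. z = (\<Sum>(x, y)\<leftarrow>ps. alg_tensor_of x y)"
proof (induction z rule: alg_tensor.abs_induct)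
  case (1 f)
  show ?case
  proof (induction f rule: update_induct)
    case const
    show ?case by (rule exI[of _ "[]"]) (simp add: zero_alg_tensor.abs_eq)
  next
    case (update f a b)
    obtain x y where a: "a = (x, y)" by (cases a)
    from update obtain ps where ps: "abs_alg_tensor f = (\<Sum>(x, y)\<leftarrow>ps. alg_tensor_of x y)" by blast
    have "Poly_Mapping.update a b f = b *\<^sub>R Poly_Mapping.single a 1 + f"
      using update(1)
      by (intro poly_mapping_eqI)
         (auto simp: lookup_update lookup_add lookup_single scaleR_poly_mapping_def
            Abs_poly_mapping_inverse when_def in_keys_iff)
    then have "abs_alg_tensor (Poly_Mapping.update a b f) =
        b *\<^sub>R abs_alg_tensor (Poly_Mapping.single a 1) + abs_alg_tensor f"
      by (simp add: plus_alg_tensor.abs_eq scaleR_alg_tensor.abs_eq)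
    also have "\<dots> = alg_tensor_of (b *\<^sub>R x) y + (\<Sum>(x, y)\<leftarrow>ps. alg_tensor_of x y)"
      by (simp add: a ps alg_tensor_of_scale_left flip: alg_tensor_of.abs_eq)
    finally show ?case by (intro exI[of _ "(b *\<^sub>R x, y) # ps"]) simp
  qed
qed


lifting_update alg_tensor.lifting
lifting_forget alg_tensor.lifting

section \<open>The projective norm\<close>

definition proj_norm :: "('a::real_normed_vector, 'b::real_normed_vector) alg_tensor \<Rightarrow> real" where
  "proj_norm z = Inf {(\<Sum>(x, y)\<leftarrow>ps. norm x * norm y) | ps.
     z = (\<Sum>(x, y)\<leftarrow>ps. alg_tensor_of x y)}"

lemma proj_cost_nonneg:
  "0 \<le> (\<Sum>(x::'a::real_normed_vector, y::'b::real_normed_vector)\<leftarrow>ps. norm x * norm y)"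
  by (rule sum_list_nonneg) auto

lemma proj_norm_upper:
  assumes "z = (\<Sum>(x, y)\<leftarrow>ps. alg_tensor_of x y)"
  shows "proj_norm z \<le> (\<Sum>(x, y)\<leftarrow>ps. norm x * norm y)"
  unfolding proj_norm_def
  by (rule cInf_lower) (use assms in \<open>auto intro!: bdd_belowI[of _ 0] proj_cost_nonneg\<close>)

lemma proj_norm_greatest:
  assumes "\<And>ps. z = (\<Sum>(x, y)\<leftarrow>ps. alg_tensor_of x y) \<Longrightarrow> c \<le> (\<Sum>(x, y)\<leftarrow>ps. norm x * norm y)"
  shows "c \<le> proj_norm z"
  unfolding proj_norm_def
  by (rule cInf_greatest) (use assms alg_tensor_exhaust[of z] in auto)

lemma proj_norm_approx:
  assumes "e > 0"
  obtains ps where "z = (\<Sum>(x, y)\<leftarrow>ps. alg_tensor_of x y)"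
    "(\<Sum>(x, y)\<leftarrow>ps. norm x * norm y) < proj_norm z + e"
proof -
  have "\<exists>ps. z = (\<Sum>(x, y)\<leftarrow>ps. alg_tensor_of x y) \<and>
    (\<Sum>(x, y)\<leftarrow>ps. norm x * norm y) < proj_norm z + e"
  proof (rule ccontr)
    assume "\<not> ?thesis"
    then have "proj_norm z + e \<le> proj_norm z"
      using leI by (intro proj_norm_greatest) blast
    with assms show False by simp
  qed
  then show ?thesis using that by blast
qed

lemma proj_norm_nonneg: "0 \<le> proj_norm z"
  by (rule proj_norm_greatest) (rule proj_cost_nonneg)

lemma proj_norm_0 [simp]:
  "proj_norm (0 :: ('a::real_normed_vector, 'b::real_normed_vector) alg_tensor) = 0"
  using proj_norm_upper[of "0 :: ('a, 'b) alg_tensor" "[]"]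
    proj_norm_nonneg[of "0 :: ('a, 'b) alg_tensor"] by simp

lemma proj_norm_triangle: "proj_norm (z + w) \<le> proj_norm z + proj_norm w"
proof (rule field_le_epsilon)
  fix e :: real assume "e > 0"
  then have e: "e / 2 > 0" by simp
  obtain ps where ps: "z = (\<Sum>(x, y)\<leftarrow>ps. alg_tensor_of x y)"
    "(\<Sum>(x, y)\<leftarrow>ps. norm x * norm y) < proj_norm z + e / 2"
    using proj_norm_approx[OF e] by blast
  obtain qs where qs: "w = (\<Sum>(x, y)\<leftarrow>qs. alg_tensor_of x y)"
    "(\<Sum>(x, y)\<leftarrow>qs. norm x * norm y) < proj_norm w + e / 2"
    using proj_norm_approx[OF e] by blast
  have "proj_norm (z + w) \<le> (\<Sum>(x, y)\<leftarrow>ps @ qs. norm x * norm y)"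
    by (rule proj_norm_upper) (simp add: ps qs)
  also have "\<dots> \<le> proj_norm z + proj_norm w + e"
    using ps(2) qs(2) by simp
  finally show "proj_norm (z + w) \<le> proj_norm z + proj_norm w + e" .
qed

lemma proj_norm_scale_le: "proj_norm (c *\<^sub>R z) \<le> \<bar>c\<bar> * proj_norm z"
proof (cases "c = 0")
  case False
  have "proj_norm (c *\<^sub>R z) / \<bar>c\<bar> \<le> proj_norm z"
  proof (rule proj_norm_greatest)
    fix ps assume z: "z = (\<Sum>(x, y)\<leftarrow>ps. alg_tensor_of x y)"
    let ?qs = "map (\<lambda>(x, y). (c *\<^sub>R x, y)) ps"
    have "c *\<^sub>R (\<Sum>(x, y)\<leftarrow>ps. alg_tensor_of x y) = (\<Sum>(x, y)\<leftarrow>?qs. alg_tensor_of x y)"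
      by (induction ps) (auto simp: scaleR_add_right alg_tensor_of_scale_left)
    then have "proj_norm (c *\<^sub>R z) \<le> (\<Sum>(x, y)\<leftarrow>?qs. norm x * norm y)"
      by (intro proj_norm_upper) (simp add: z)
    also have "\<dots> = \<bar>c\<bar> * (\<Sum>(x, y)\<leftarrow>ps. norm x * norm y)"
      by (induction ps) (auto simp: algebra_simps)
    finally show "proj_norm (c *\<^sub>R z) / \<bar>c\<bar> \<le> (\<Sum>(x, y)\<leftarrow>ps. norm x * norm y)"
      using False by (simp add: field_simps)
  qed
  with False show ?thesis by (simp add: field_simps)
qed simp

lemma proj_norm_scale: "proj_norm (c *\<^sub>R z) = \<bar>c\<bar> * proj_norm z"
proof (cases "c = 0")
  case False
  have "proj_norm z \<le> \<bar>inverse c\<bar> * proj_norm (c *\<^sub>R z)"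
    using proj_norm_scale_le[of "inverse c" "c *\<^sub>R z"] False by simp
  with False have "\<bar>c\<bar> * proj_norm z \<le> proj_norm (c *\<^sub>R z)"
    by (simp add: field_simps abs_inverse)
  with proj_norm_scale_le[of c z] show ?thesis by simp
qed simp

lemma proj_norm_minus [simp]: "proj_norm (- z) = proj_norm z"
  using proj_norm_scale[of "-1" z] by simp

lemma proj_norm_commute: "proj_norm (z - w) = proj_norm (w - z)"
  by (metis minus_diff_eq proj_norm_minus)

lemma proj_norm_triangle_sub: "proj_norm (z - v) \<le> proj_norm (z - w) + proj_norm (w - v)"
  using proj_norm_triangle[of "z - w" "w - v"] by simp

lemma proj_norm_triangle3: "\<bar>proj_norm z - proj_norm w\<bar> \<le> proj_norm (z - w)"
  using proj_norm_triangle[of "z - w" w] proj_norm_triangle[of "w - z" z]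
  by (simp add: proj_norm_commute[of w z])

lemma proj_norm_alg_tensor_of_le: "proj_norm (alg_tensor_of x y) \<le> norm x * norm y"
  using proj_norm_upper[of "alg_tensor_of x y" "[(x, y)]"] by simp

section \<open>The completed projective tensor product\<close>

definition proj_cauchy ::
  "(nat \<Rightarrow> ('a::real_normed_vector, 'b::real_normed_vector) alg_tensor) \<Rightarrow> bool" where
  "proj_cauchy X \<longleftrightarrow> (\<forall>e>0. \<exists>N. \<forall>m\<ge>N. \<forall>n\<ge>N. proj_norm (X m - X n) < e)"

definition proj_null ::
  "(nat \<Rightarrow> ('a::real_normed_vector, 'b::real_normed_vector) alg_tensor) \<Rightarrow> bool" where
  "proj_null X \<longleftrightarrow> (\<lambda>n. proj_norm (X n)) \<longlonglongrightarrow> 0"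

lemma proj_cauchy_const: "proj_cauchy (\<lambda>_. z)"
  by (simp add: proj_cauchy_def)

lemma proj_cauchy_add:
  assumes "proj_cauchy X" "proj_cauchy Y"
  shows "proj_cauchy (\<lambda>n. X n + Y n)"
  unfolding proj_cauchy_def
proof (intro allI impI)
  fix e :: real assume "e > 0"
  then have "e / 2 > 0" by simp
  then obtain M N where M: "\<And>m n. m \<ge> M \<Longrightarrow> n \<ge> M \<Longrightarrow> proj_norm (X m - X n) < e / 2"
    and N: "\<And>m n. m \<ge> N \<Longrightarrow> n \<ge> N \<Longrightarrow> proj_norm (Y m - Y n) < e / 2"
    using assms unfolding proj_cauchy_def by metis
  have "proj_norm (X m + Y m - (X n + Y n)) < e" if "m \<ge> max M N" "n \<ge> max M N" for m n
    using that M[of m n] N[of m n] proj_norm_triangle[of "X m - X n" "Y m - Y n"]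
    by (simp add: algebra_simps)
  then show "\<exists>N. \<forall>m\<ge>N. \<forall>n\<ge>N. proj_norm (X m + Y m - (X n + Y n)) < e" by blast
qed

lemma proj_cauchy_scale:
  assumes "proj_cauchy X"
  shows "proj_cauchy (\<lambda>n. c *\<^sub>R X n)"
proof (cases "c = 0")
  case False
  show ?thesis
    unfolding proj_cauchy_def
  proof (intro allI impI)
    fix e :: real assume "e > 0"
    with False have "e / \<bar>c\<bar> > 0" by simp
    then obtain N where "\<And>m n. m \<ge> N \<Longrightarrow> n \<ge> N \<Longrightarrow> proj_norm (X m - X n) < e / \<bar>c\<bar>"
      using assms unfolding proj_cauchy_def by metis
    then show "\<exists>N. \<forall>m\<ge>N. \<forall>n\<ge>N. proj_norm (c *\<^sub>R X m - c *\<^sub>R X n) < e"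
      using False unfolding scaleR_diff_right[symmetric] proj_norm_scale
      by (intro exI[of _ N]) (auto simp: pos_less_divide_eq mult.commute)
  qed
qed (simp add: proj_cauchy_const)

lemma proj_cauchy_minus: "proj_cauchy X \<Longrightarrow> proj_cauchy (\<lambda>n. - X n)"
  using proj_cauchy_scale[of X "-1"] by simp

lemma proj_cauchy_diff: "proj_cauchy X \<Longrightarrow> proj_cauchy Y \<Longrightarrow> proj_cauchy (\<lambda>n. X n - Y n)"
  using proj_cauchy_add[of X "\<lambda>n. - Y n"] proj_cauchy_minus[of Y] by simp

lemma proj_cauchy_norm: "proj_cauchy X \<Longrightarrow> convergent (\<lambda>n. proj_norm (X n))"
  unfolding Cauchy_convergent_iff[symmetric] Cauchy_def proj_cauchy_def dist_real_def
  by (meson order_le_less_trans proj_norm_triangle3)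

lemma proj_cauchy_norm_tendsto:
  "proj_cauchy X \<Longrightarrow> (\<lambda>n. proj_norm (X n)) \<longlonglongrightarrow> lim (\<lambda>n. proj_norm (X n))"
  using proj_cauchy_norm by (simp add: convergent_LIMSEQ_iff)

lemma proj_null_0: "proj_null (\<lambda>_. 0)"
  by (simp add: proj_null_def)

lemma proj_null_add: "proj_null X \<Longrightarrow> proj_null Y \<Longrightarrow> proj_null (\<lambda>n. X n + Y n)"
  unfolding proj_null_def
  using Lim_null_comparison[OF always_eventually tendsto_add_zero,
      of "\<lambda>n. proj_norm (X n + Y n)" "\<lambda>n. proj_norm (X n)" "\<lambda>n. proj_norm (Y n)"]
  by (simp add: proj_norm_nonneg proj_norm_triangle)

lemma proj_null_scale: "proj_null X \<Longrightarrow> proj_null (\<lambda>n. c *\<^sub>R X n)"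
  unfolding proj_null_def by (simp add: proj_norm_scale tendsto_mult_right_zero)

lemma proj_null_minus: "proj_null X \<Longrightarrow> proj_null (\<lambda>n. - X n)"
  by (simp add: proj_null_def)

text \<open>
  The completion of the algebraic tensor product with respect to the projective norm: Cauchy
  sequences modulo sequences with null difference. By the Hahn--Banach theorem \<^const>\<open>proj_norm\<close> vanishes
  only at \<open>0\<close>, so the canonical map \<open>proj_tensor_of_alg\<close> below is injective; the construction does
  not depend on this.
\<close>

quotient_type (overloaded) ('a, 'b) proj_tensor =
  "nat \<Rightarrow> ('a::real_normed_vector, 'b::real_normed_vector) alg_tensor" /
  partial: "\<lambda>X Y. proj_cauchy X \<and> proj_cauchy Y \<and> proj_null (\<lambda>n. X n - Y n)"
proof (rule part_equivpI)
  show "\<exists>X::nat \<Rightarrow> ('a, 'b) alg_tensor. proj_cauchy X \<and> proj_cauchy X \<and> proj_null (\<lambda>n. X n - X n)"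
    using proj_cauchy_const proj_null_0 by auto
  show "symp (\<lambda>X Y::nat \<Rightarrow> ('a, 'b) alg_tensor.
      proj_cauchy X \<and> proj_cauchy Y \<and> proj_null (\<lambda>n. X n - Y n))"
  proof (rule sympI)
    fix X Y :: "nat \<Rightarrow> ('a, 'b) alg_tensor"
    assume "proj_cauchy X \<and> proj_cauchy Y \<and> proj_null (\<lambda>n. X n - Y n)"
    then show "proj_cauchy Y \<and> proj_cauchy X \<and> proj_null (\<lambda>n. Y n - X n)"
      using proj_null_minus[of "\<lambda>n. X n - Y n"] by simp
  qed
  show "transp (\<lambda>X Y::nat \<Rightarrow> ('a, 'b) alg_tensor.
      proj_cauchy X \<and> proj_cauchy Y \<and> proj_null (\<lambda>n. X n - Y n))"
  proof (rule transpI)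
    fix X Y Z :: "nat \<Rightarrow> ('a, 'b) alg_tensor"
    assume "proj_cauchy X \<and> proj_cauchy Y \<and> proj_null (\<lambda>n. X n - Y n)"
      "proj_cauchy Y \<and> proj_cauchy Z \<and> proj_null (\<lambda>n. Y n - Z n)"
    then show "proj_cauchy X \<and> proj_cauchy Z \<and> proj_null (\<lambda>n. X n - Z n)"
      using proj_null_add[of "\<lambda>n. X n - Y n" "\<lambda>n. Y n - Z n"] by simp
  qed
qed

instantiation proj_tensor :: (real_normed_vector, real_normed_vector) real_normed_vector
begin

lift_definition zero_proj_tensor :: "('a, 'b) proj_tensor" is "\<lambda>_. 0"
  by (simp add: proj_cauchy_const proj_null_0)

lift_definition plus_proj_tensor ::
  "('a, 'b) proj_tensor \<Rightarrow> ('a, 'b) proj_tensor \<Rightarrow> ('a, 'b) proj_tensor" is "\<lambda>X Y n. X n + Y n"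
  subgoal for X X' Y Y'
    using proj_null_add[of "\<lambda>n. X n - X' n" "\<lambda>n. Y n - Y' n"]
    by (simp add: proj_cauchy_add algebra_simps)
  done

lift_definition uminus_proj_tensor :: "('a, 'b) proj_tensor \<Rightarrow> ('a, 'b) proj_tensor" is "\<lambda>X n. - X n"
  subgoal for X X'
    using proj_null_minus[of "\<lambda>n. X n - X' n"] by (simp add: proj_cauchy_minus algebra_simps)
  done

lift_definition minus_proj_tensor ::
  "('a, 'b) proj_tensor \<Rightarrow> ('a, 'b) proj_tensor \<Rightarrow> ('a, 'b) proj_tensor" is "\<lambda>X Y n. X n - Y n"
  subgoal for X X' Y Y'
    using proj_null_add[of "\<lambda>n. X n - X' n" "\<lambda>n. - (Y n - Y' n)"]
      proj_null_minus[of "\<lambda>n. Y n - Y' n"]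
    by (simp add: proj_cauchy_diff algebra_simps)
  done

lift_definition scaleR_proj_tensor :: "real \<Rightarrow> ('a, 'b) proj_tensor \<Rightarrow> ('a, 'b) proj_tensor" is
  "\<lambda>c X n. c *\<^sub>R X n"
  by (auto simp: proj_cauchy_scale proj_null_scale simp flip: scaleR_diff_right)

lift_definition norm_proj_tensor :: "('a, 'b) proj_tensor \<Rightarrow> real" is
  "\<lambda>X. lim (\<lambda>n. proj_norm (X n))"
proof -
  fix X Y :: "nat \<Rightarrow> ('a, 'b) alg_tensor"
  assume *: "proj_cauchy X \<and> proj_cauchy Y \<and> proj_null (\<lambda>n. X n - Y n)"
  then obtain a b where ab: "(\<lambda>n. proj_norm (X n)) \<longlonglongrightarrow> a" "(\<lambda>n. proj_norm (Y n)) \<longlonglongrightarrow> b"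
    using proj_cauchy_norm convergent_def by metis
  have "(\<lambda>n. proj_norm (X n) - proj_norm (Y n)) \<longlonglongrightarrow> 0"
    by (rule Lim_null_comparison[OF always_eventually, of _ "\<lambda>n. proj_norm (X n - Y n)"])
       (use * in \<open>auto simp: proj_null_def proj_norm_triangle3\<close>)
  with tendsto_diff[OF ab] have "a - b = 0" using LIMSEQ_unique by blast
  with ab show "lim (\<lambda>n. proj_norm (X n)) = lim (\<lambda>n. proj_norm (Y n))"
    by (simp add: limI)
qed

definition dist_proj_tensor :: "('a, 'b) proj_tensor \<Rightarrow> ('a, 'b) proj_tensor \<Rightarrow> real" where
  "dist_proj_tensor z w = norm (z - w)"

definition sgn_proj_tensor :: "('a, 'b) proj_tensor \<Rightarrow> ('a, 'b) proj_tensor" where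
  "sgn_proj_tensor z = inverse (norm z) *\<^sub>R z"

definition uniformity_proj_tensor :: "(('a, 'b) proj_tensor \<times> ('a, 'b) proj_tensor) filter" where
  "uniformity_proj_tensor = (INF e\<in>{0<..}. principal {(z, w). dist z w < e})"

definition open_proj_tensor :: "('a, 'b) proj_tensor set \<Rightarrow> bool" where
  "open_proj_tensor S = (\<forall>z\<in>S. \<forall>\<^sub>F (z', w) in uniformity. z' = z \<longrightarrow> w \<in> S)"

instance
proof
  fix x y z :: "('a, 'b) proj_tensor" and a b :: real
  show "x + y + z = x + (y + z)" "x + y = y + x" "0 + x = x" "- x + x = 0" "x - y = x + - y"
    "a *\<^sub>R (x + y) = a *\<^sub>R x + a *\<^sub>R y" "(a + b) *\<^sub>R x = a *\<^sub>R x + b *\<^sub>R x"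
    "a *\<^sub>R b *\<^sub>R x = (a * b) *\<^sub>R x" "1 *\<^sub>R x = x"
    by (transfer; simp add: proj_null_0 proj_cauchy_add proj_cauchy_minus proj_cauchy_diff
          proj_cauchy_scale proj_cauchy_const algebra_simps)+
  show "norm x = 0 \<longleftrightarrow> x = 0"
  proof transfer
    fix X :: "nat \<Rightarrow> ('a, 'b) alg_tensor"
    assume "proj_cauchy X \<and> proj_cauchy X \<and> proj_null (\<lambda>n. X n - X n)"
    then have X: "proj_cauchy X" by blast
    have "lim (\<lambda>n. proj_norm (X n)) = 0 \<longleftrightarrow> (\<lambda>n. proj_norm (X n)) \<longlonglongrightarrow> 0"
      using proj_cauchy_norm_tendsto[OF X] LIMSEQ_unique by metis
    with X show "lim (\<lambda>n. proj_norm (X n)) = 0 \<longleftrightarrow>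
        proj_cauchy X \<and> proj_cauchy (\<lambda>_. 0) \<and> proj_null (\<lambda>n. X n - 0)"
      by (simp add: proj_null_def proj_cauchy_const)
  qed
  show "norm (x + y) \<le> norm x + norm y"
  proof transfer
    fix X Y :: "nat \<Rightarrow> ('a, 'b) alg_tensor"
    assume "proj_cauchy X \<and> proj_cauchy X \<and> proj_null (\<lambda>n. X n - X n)"
      "proj_cauchy Y \<and> proj_cauchy Y \<and> proj_null (\<lambda>n. Y n - Y n)"
    then have "(\<lambda>n. proj_norm (X n)) \<longlonglongrightarrow> lim (\<lambda>n. proj_norm (X n))"
      "(\<lambda>n. proj_norm (Y n)) \<longlonglongrightarrow> lim (\<lambda>n. proj_norm (Y n))"
      "(\<lambda>n. proj_norm (X n + Y n)) \<longlonglongrightarrow> lim (\<lambda>n. proj_norm (X n + Y n))"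
      by (simp_all add: proj_cauchy_norm_tendsto proj_cauchy_add)
    then show "lim (\<lambda>n. proj_norm (X n + Y n)) \<le>
        lim (\<lambda>n. proj_norm (X n)) + lim (\<lambda>n. proj_norm (Y n))"
      by (intro LIMSEQ_le[OF _ tendsto_add]) (auto simp: proj_norm_triangle)
  qed
  show "norm (a *\<^sub>R x) = \<bar>a\<bar> * norm x"
  proof transfer
    fix a :: real and X :: "nat \<Rightarrow> ('a, 'b) alg_tensor"
    assume "proj_cauchy X \<and> proj_cauchy X \<and> proj_null (\<lambda>n. X n - X n)"
    then have "(\<lambda>n. proj_norm (X n)) \<longlonglongrightarrow> lim (\<lambda>n. proj_norm (X n))"
      by (simp add: proj_cauchy_norm_tendsto)
    then show "lim (\<lambda>n. proj_norm (a *\<^sub>R X n)) = \<bar>a\<bar> * lim (\<lambda>n. proj_norm (X n))"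
      unfolding proj_norm_scale by (intro limI tendsto_mult_left)
  qed
qed (rule dist_proj_tensor_def sgn_proj_tensor_def
      uniformity_proj_tensor_def open_proj_tensor_def)+

end

lift_definition proj_tensor_of_alg ::
  "('a::real_normed_vector, 'b::real_normed_vector) alg_tensor \<Rightarrow> ('a, 'b) proj_tensor" is
  "\<lambda>z _. z"
  by (simp add: proj_cauchy_const proj_null_0)

lemma linear_proj_tensor_of_alg: "linear proj_tensor_of_alg"
  by (rule linearI; transfer; simp add: proj_cauchy_const proj_null_0)

lemma norm_proj_tensor_of_alg: "norm (proj_tensor_of_alg z) = proj_norm z"
  by transfer simp

lemma proj_tensor_of_alg_tendsto:
  assumes "proj_cauchy X"
  shows "(\<lambda>n. proj_tensor_of_alg (X n)) \<longlonglongrightarrow> abs_proj_tensor X"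
proof -
  have "(\<lambda>n. norm (proj_tensor_of_alg (X n) - abs_proj_tensor X)) \<longlonglongrightarrow> 0"
  proof (rule LIMSEQ_I)
    fix r :: real assume "0 < r"
    then have "r / 2 > 0" by simp
    then obtain N where N: "\<And>m n. m \<ge> N \<Longrightarrow> n \<ge> N \<Longrightarrow> proj_norm (X m - X n) < r / 2"
      using assms unfolding proj_cauchy_def by metis
    have "norm (proj_tensor_of_alg (X n) - abs_proj_tensor X) < r" if "n \<ge> N" for n
    proof -
      have c: "proj_cauchy (\<lambda>m. X n - X m)"
        using assms by (intro proj_cauchy_diff proj_cauchy_const)
      have eq: "proj_tensor_of_alg (X n) - abs_proj_tensor X = abs_proj_tensor (\<lambda>m. X n - X m)"
        using assms
        by (simp add: proj_tensor_of_alg.abs_eq minus_proj_tensor.abs_eq eq_onp_def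
            proj_cauchy_const proj_null_0)
      have "lim (\<lambda>m. proj_norm (X n - X m)) \<le> r / 2"
        using proj_cauchy_norm[OF c] N[OF that]
        by (intro Lim_bounded[of _ _ N]) (auto simp: convergent_LIMSEQ_iff less_imp_le)
      then show ?thesis
        using c \<open>0 < r\<close> unfolding eq by (simp add: norm_proj_tensor.abs_eq proj_null_0)
    qed
    then show "\<exists>no. \<forall>n\<ge>no. norm (norm (proj_tensor_of_alg (X n) - abs_proj_tensor X) - 0) < r"
      by auto
  qed
  then show ?thesis unfolding tendsto_norm_zero_iff by (rule LIM_zero_cancel)
qed

lemma proj_tensor_approx:
  assumes "e > 0"
  shows "\<exists>a. norm (z - proj_tensor_of_alg a) < e"
proof (induction z rule: proj_tensor.abs_induct)
  case (1 X)
  then have "(\<lambda>n. proj_tensor_of_alg (X n)) \<longlonglongrightarrow> abs_proj_tensor X"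
    by (intro proj_tensor_of_alg_tendsto) simp
  from LIMSEQ_D[OF this assms] show ?case
    by (metis norm_minus_commute order_refl)
qed

instance proj_tensor :: (real_normed_vector, real_normed_vector) banach
proof
  fix Z :: "nat \<Rightarrow> ('a, 'b) proj_tensor"
  assume Z: "Cauchy Z"
  have "\<forall>n. \<exists>a. norm (Z n - proj_tensor_of_alg a) < inverse (real (Suc n))"
    by (intro allI proj_tensor_approx) simp
  then obtain X where X: "\<And>n. norm (Z n - proj_tensor_of_alg (X n)) < inverse (real (Suc n))"
    by metis
  have null: "(\<lambda>n. Z n - proj_tensor_of_alg (X n)) \<longlonglongrightarrow> 0"
    by (rule Lim_null_comparison[OF always_eventually LIMSEQ_inverse_real_of_nat])
       (use X less_imp_le in blast)
  have "proj_cauchy X"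
    unfolding proj_cauchy_def
  proof (intro allI impI)
    fix e :: real assume "e > 0"
    then have e: "e / 3 > 0" by simp
    obtain M where M: "\<And>m n. m \<ge> M \<Longrightarrow> n \<ge> M \<Longrightarrow> norm (Z m - Z n) < e / 3"
      using CauchyD[OF Z e] by blast
    obtain N where N: "\<And>n. n \<ge> N \<Longrightarrow> norm (Z n - proj_tensor_of_alg (X n)) < e / 3"
      using LIMSEQ_D[OF null e] by auto
    have "proj_norm (X m - X n) < e" if "m \<ge> max M N" "n \<ge> max M N" for m n
    proof -
      have "proj_tensor_of_alg (X m - X n) = (Z m - Z n) - (Z m - proj_tensor_of_alg (X m))
          + (Z n - proj_tensor_of_alg (X n))"
        by (simp add: linear_diff[OF linear_proj_tensor_of_alg])
      also have "norm \<dots> \<le> norm (Z m - Z n) + norm (Z m - proj_tensor_of_alg (X m))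
          + norm (Z n - proj_tensor_of_alg (X n))"
        by (intro norm_triangle_le add_mono norm_triangle_ineq4 order_refl)
      finally show ?thesis
        using that M[of m n] N[of m] N[of n] by (simp add: norm_proj_tensor_of_alg)
    qed
    then show "\<exists>N. \<forall>m\<ge>N. \<forall>n\<ge>N. proj_norm (X m - X n) < e" by blast
  qed
  from tendsto_add[OF null proj_tensor_of_alg_tendsto[OF this]]
  show "convergent Z" by (auto simp: convergent_def)
qed

definition proj_tensor_of ::
  "'a::real_normed_vector \<Rightarrow> 'b::real_normed_vector \<Rightarrow> ('a, 'b) proj_tensor"
  (infixr \<open>\<otimes>\<^sub>\<pi>\<close> 75) where
  "x \<otimes>\<^sub>\<pi> y = proj_tensor_of_alg (alg_tensor_of x y)"

lemma bounded_bilinear_proj_tensor_of: "bounded_bilinear (\<otimes>\<^sub>\<pi>)"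
proof
  show "\<exists>K. \<forall>(a::'a) (b::'b). norm (a \<otimes>\<^sub>\<pi> b) \<le> norm a * norm b * K"
    by (rule exI[of _ 1]) (simp add: proj_tensor_of_def norm_proj_tensor_of_alg
        proj_norm_alg_tensor_of_le)
qed (simp_all add: proj_tensor_of_def alg_tensor_of_add_left alg_tensor_of_add_right
      alg_tensor_of_scale_left alg_tensor_of_scale_right
      linear_add[OF linear_proj_tensor_of_alg] linear_scale[OF linear_proj_tensor_of_alg])

section \<open>The symmetric projective tensor product\<close>

definition sym_tensors :: "('a::real_normed_vector, 'a) proj_tensor set" where
  "sym_tensors = closure (span (range (\<lambda>u. u \<otimes>\<^sub>\<pi> u)))"

lemma subspace_sym_tensors: "subspace sym_tensors"
  unfolding sym_tensors_def
proof (rule subspaceI)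
  let ?S = "span (range (\<lambda>u::'a. u \<otimes>\<^sub>\<pi> u))"
  show "0 \<in> closure ?S" by (rule subsetD[OF closure_subset span_zero])
  show "x + y \<in> closure ?S" if x: "x \<in> closure ?S" and y: "y \<in> closure ?S" for x y
  proof -
    obtain X Y where "\<And>n. X n \<in> ?S" "X \<longlonglongrightarrow> x" "\<And>n. Y n \<in> ?S" "Y \<longlonglongrightarrow> y"
      using x y unfolding closure_sequential by blast
    then show ?thesis
      unfolding closure_sequential
      by (intro exI[of _ "\<lambda>n. X n + Y n"]) (auto intro: span_add tendsto_add)
  qed
  show "c *\<^sub>R x \<in> closure ?S" if x: "x \<in> closure ?S" for c x
  proof -
    obtain X where "\<And>n. X n \<in> ?S" "X \<longlonglongrightarrow> x"
      using x unfolding closure_sequential by blast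
    then show ?thesis
      unfolding closure_sequential
      by (intro exI[of _ "\<lambda>n. c *\<^sub>R X n"]) (auto intro: span_scale tendsto_scaleR)
  qed
qed

typedef (overloaded) 'a sym_tensor = "sym_tensors :: ('a::real_normed_vector, 'a) proj_tensor set"
  using subspace_0[OF subspace_sym_tensors] by blast

setup_lifting type_definition_sym_tensor

instantiation sym_tensor :: (real_normed_vector) real_normed_vector
begin

lift_definition zero_sym_tensor :: "'a sym_tensor" is 0
  by (rule subspace_0[OF subspace_sym_tensors])

lift_definition plus_sym_tensor :: "'a sym_tensor \<Rightarrow> 'a sym_tensor \<Rightarrow> 'a sym_tensor" is "(+)"
  by (rule subspace_add[OF subspace_sym_tensors])

lift_definition minus_sym_tensor :: "'a sym_tensor \<Rightarrow> 'a sym_tensor \<Rightarrow> 'a sym_tensor" is "(-)"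
  by (rule subspace_diff[OF subspace_sym_tensors])

lift_definition uminus_sym_tensor :: "'a sym_tensor \<Rightarrow> 'a sym_tensor" is uminus
  by (rule subspace_neg[OF subspace_sym_tensors])

lift_definition scaleR_sym_tensor :: "real \<Rightarrow> 'a sym_tensor \<Rightarrow> 'a sym_tensor" is "(*\<^sub>R)"
  by (rule subspace_scale[OF subspace_sym_tensors])

lift_definition norm_sym_tensor :: "'a sym_tensor \<Rightarrow> real" is norm .

definition dist_sym_tensor :: "'a sym_tensor \<Rightarrow> 'a sym_tensor \<Rightarrow> real" where
  "dist_sym_tensor z w = norm (z - w)"

definition sgn_sym_tensor :: "'a sym_tensor \<Rightarrow> 'a sym_tensor" where
  "sgn_sym_tensor z = inverse (norm z) *\<^sub>R z"

definition uniformity_sym_tensor :: "('a sym_tensor \<times> 'a sym_tensor) filter" where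
  "uniformity_sym_tensor = (INF e\<in>{0<..}. principal {(z, w). dist z w < e})"

definition open_sym_tensor :: "'a sym_tensor set \<Rightarrow> bool" where
  "open_sym_tensor S = (\<forall>z\<in>S. \<forall>\<^sub>F (z', w) in uniformity. z' = z \<longrightarrow> w \<in> S)"

instance
proof
  fix x y z :: "'a sym_tensor" and a b :: real
  show "x + y + z = x + (y + z)" "x + y = y + x" "0 + x = x" "- x + x = 0" "x - y = x + - y"
    "a *\<^sub>R (x + y) = a *\<^sub>R x + a *\<^sub>R y" "(a + b) *\<^sub>R x = a *\<^sub>R x + b *\<^sub>R x"
    "a *\<^sub>R b *\<^sub>R x = (a * b) *\<^sub>R x" "1 *\<^sub>R x = x"
    "norm x = 0 \<longleftrightarrow> x = 0" "norm (x + y) \<le> norm x + norm y" "norm (a *\<^sub>R x) = \<bar>a\<bar> * norm x"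
    by (transfer; simp add: algebra_simps norm_triangle_ineq)+
qed (rule dist_sym_tensor_def sgn_sym_tensor_def
      uniformity_sym_tensor_def open_sym_tensor_def)+

end

lemma linear_Rep_sym_tensor: "linear Rep_sym_tensor"
  by (rule linearI) (simp_all add: plus_sym_tensor.rep_eq scaleR_sym_tensor.rep_eq)

lemma dist_Rep_sym_tensor: "dist (Rep_sym_tensor z) (Rep_sym_tensor w) = dist z w"
  by (simp add: dist_norm norm_sym_tensor.rep_eq minus_sym_tensor.rep_eq)

instance sym_tensor :: (real_normed_vector) banach
proof
  fix Z :: "nat \<Rightarrow> 'a sym_tensor"
  assume "Cauchy Z"
  then have "Cauchy (\<lambda>n. Rep_sym_tensor (Z n))"
    by (simp add: Cauchy_def dist_Rep_sym_tensor)
  then obtain l where l: "(\<lambda>n. Rep_sym_tensor (Z n)) \<longlonglongrightarrow> l"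
    using Cauchy_convergent convergent_def by blast
  have "closed (sym_tensors :: ('a, 'a) proj_tensor set)" by (simp add: sym_tensors_def)
  then have "l \<in> sym_tensors"
    by (rule closed_sequentially[OF _ _ l]) (rule Rep_sym_tensor)
  then have "Rep_sym_tensor (Abs_sym_tensor l) = l" by (rule Abs_sym_tensor_inverse)
  with l have "(\<lambda>n. Rep_sym_tensor (Z n)) \<longlonglongrightarrow> Rep_sym_tensor (Abs_sym_tensor l)" by simp
  then have "Z \<longlonglongrightarrow> Abs_sym_tensor l"
    unfolding lim_sequentially dist_Rep_sym_tensor .
  then show "convergent Z" by (auto simp: convergent_def)
qed

lift_definition sym_square :: "'a::real_normed_vector \<Rightarrow> 'a sym_tensor" is "\<lambda>u. u \<otimes>\<^sub>\<pi> u"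
  unfolding sym_tensors_def by (rule subsetD[OF closure_subset]) (rule span_base[OF rangeI])

section \<open>Dilinear mappings\<close>

text \<open>
  A linear map on the Cartesian product \<open>X \<times> (X \<otimes> X)\<close>, not a bilinear one; the product carries the
  library's Euclidean product norm, which is equivalent to any other product norm.
\<close>

definition dilinear_rep ::
  "('a::real_normed_vector \<Rightarrow> 'b::real_normed_vector) \<Rightarrow> ('a \<times> 'a sym_tensor \<Rightarrow> 'b) \<Rightarrow> bool" where
  "dilinear_rep K B \<longleftrightarrow> linear B \<and> (\<forall>u. K u = B (u, sym_square u))"

definition dilinear :: "('a::real_normed_vector \<Rightarrow> 'b::real_normed_vector) \<Rightarrow> bool" where
  "dilinear K \<longleftrightarrow> (\<exists>B. dilinear_rep K B)"

definition bounded_dilinear :: "('a::real_normed_vector \<Rightarrow> 'b::real_normed_vector) \<Rightarrow> bool" where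
  "bounded_dilinear K \<longleftrightarrow> (\<exists>B. dilinear_rep K B \<and> bounded_linear B)"

lemma bounded_dilinear_imp_dilinear: "bounded_dilinear K \<Longrightarrow> dilinear K"
  by (auto simp: bounded_dilinear_def dilinear_def)

end

(* If D is the difference of two bounded representatives, D (u, u \<otimes> u) = 0 for all u; comparing u
   with -u separates the two components, so D (u, 0) = 0 and D (0, u \<otimes> u) = 0. Since the squares
   u \<otimes> u span a dense subspace, D = 0 by continuity. *)
theory Submission
  imports Defs
begin

text \<open>The two signs cancel by bilinearity. This evenness, against the oddness of
  \<open>u\<close> itself, is what separates the two components of a representative.\<close>

lemma sym_square_minus: "sym_square (- u) = sym_square u"
  by transfer
     (simp add: bounded_bilinear.minus_left[OF bounded_bilinear_proj_tensor_of]
        bounded_bilinear.minus_right[OF bounded_bilinear_proj_tensor_of])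

text \<open>\<open>sym_tensors\<close> is by definition a closure inside the ambient tensor product.
  As \<open>Rep_sym_tensor\<close> is linear and isometric, it matches the two spans and preserves
  distances, so density passes to the subtype.\<close>

lemma closure_span_sym_squares: "closure (span (range sym_square)) = UNIV"
proof (intro equalityI subset_UNIV subsetI)
  fix z :: "'a sym_tensor"
  have "Rep_sym_tensor ` span (range sym_square) =
      span (Rep_sym_tensor ` range (sym_square :: 'a \<Rightarrow> 'a sym_tensor))"
    by (rule linear_span_image[OF linear_Rep_sym_tensor, symmetric])
  then have span: "span (range (\<lambda>u::'a. u \<otimes>\<^sub>\<pi> u)) = Rep_sym_tensor ` span (range sym_square)"
    by (simp add: image_image sym_square.rep_eq)
  show "z \<in> closure (span (range sym_square))"
    unfolding closure_approachable
  proof (intro allI impI)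
    fix e :: real
    assume "e > 0"
    then have "\<exists>w\<in>Rep_sym_tensor ` span (range sym_square). dist w (Rep_sym_tensor z) < e"
      using Rep_sym_tensor[of z] unfolding sym_tensors_def span closure_approachable by blast
    then show "\<exists>w\<in>span (range sym_square). dist w z < e"
      by (auto simp: dist_Rep_sym_tensor)
  qed
qed

text \<open>Linearity extends the vanishing from squares to their span, and continuity extends it to
  the closure, which is the whole space.\<close>

lemma bounded_linear_eq_0_sym_squares:
  fixes g :: "'a::real_normed_vector sym_tensor \<Rightarrow> 'b::real_normed_vector"
  assumes g: "bounded_linear g" and zero: "\<And>u. g (sym_square u) = 0"
  shows "g z = 0"
proof -
  have "g w = 0" if "w \<in> span (range sym_square)" for w
    using linear_eq_0_on_span[OF bounded_linear.linear[OF g] _ that] zero by auto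
  then show ?thesis
    using continuous_constant_on_closure[of "span (range sym_square)" g 0 z]
      linear_continuous_on[OF g] by (simp add: closure_span_sym_squares)
qed

lemma bounded_linear_eq_0_dilinear:
  fixes D :: "'a::real_normed_vector \<times> 'a sym_tensor \<Rightarrow> 'b::real_normed_vector"
  assumes D: "bounded_linear D" and zero: "\<And>u. D (u, sym_square u) = 0"
  shows "D = (\<lambda>_. 0)"
proof
  interpret D: bounded_linear D by (rule D)
  have split: "D (u, z) = D (u, 0) + D (0, z)" for u z
    using D.add[of "(u, 0)" "(0, z)"] by simp
  have minus: "D (- u, 0) = - D (u, 0)" for u
    using linear_neg[OF D.linear, of "(u, 0)"] by simp
  have plus: "D (u, 0) + D (0, sym_square u) = 0" for u
    using split[of u "sym_square u"] zero[of u] by simp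
  have eq: "D (u, 0) = 0" for u
  proof -
    \<comment> \<open>Passing to \<open>- u\<close> in \<open>plus\<close> flips the sign of the
      first term only; together with \<open>plus\<close> at \<open>u\<close> this forces twice the
      first term to be 0.\<close>
    have "D (0, sym_square u) = D (u, 0)"
      using plus[of "- u"] by (simp add: sym_square_minus minus)
    then have "2 *\<^sub>R D (u, 0) = 0"
      using plus[of u] by (simp only: scaleR_2)
    then show ?thesis by simp
  qed
  \<comment> \<open>The restriction of \<open>D\<close> to the second factor vanishes on squares by
    \<open>plus\<close> and \<open>eq\<close>, so the density argument applies to it.\<close>
  have "bounded_linear (\<lambda>z. D (0, z))"
    by (intro bounded_linear_compose[OF D] bounded_linear_Pair
        bounded_linear_zero bounded_linear_ident)
  then have "D (0, z) = 0" for z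
    by (rule bounded_linear_eq_0_sym_squares) (use plus eq in simp)
  then show "D p = 0" for p
    using split[of "fst p" "snd p"] by (simp add: eq)
qed

theorem lemma2p6:
  fixes K :: "'a::banach \<Rightarrow> 'b::banach"
  assumes "bounded_dilinear K"
  shows "\<exists>!B :: 'a \<times> 'a sym_tensor \<Rightarrow> 'b.
    bounded_linear B \<and> (\<forall>u. K u = B (u, sym_square u))"
proof (rule ex_ex1I)
  show "\<exists>B :: 'a \<times> 'a sym_tensor \<Rightarrow> 'b. bounded_linear B \<and> (\<forall>u. K u = B (u, sym_square u))"
    using assms by (auto simp: bounded_dilinear_def dilinear_rep_def)
next
  fix B C :: "'a \<times> 'a sym_tensor \<Rightarrow> 'b"
  assume B: "bounded_linear B \<and> (\<forall>u. K u = B (u, sym_square u))"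
    and C: "bounded_linear C \<and> (\<forall>u. K u = C (u, sym_square u))"
  then have eq: "B (u, sym_square u) = C (u, sym_square u)" for u
    by metis
  \<comment> \<open>By \<open>eq\<close>, the difference of the two representatives vanishes on the
    graph of \<open>sym_square\<close>.\<close>
  have "(\<lambda>p. B p - C p) = (\<lambda>_. 0)"
    by (intro bounded_linear_eq_0_dilinear bounded_linear_sub)
       (use B C in blast, use B C in blast, simp add: eq)
  then show "B = C" by (simp add: fun_eq_iff)
qed

end
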